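(* For all $\tau\in\mathbb{H}$: (1) $g(\tau)-g(\tau)^2-4g(\tau)g(2\tau)-g(2\tau)^2+5g(\tau)g(2\tau)^2=0$; (2) $U(\tau)^4+4U(\tau)^2U(2\tau)^2+U(2\tau)^4=U(2\tau)^2\bigl(1+5U(\tau)^4\bigr)$.
   Context: $q=e^{2\pi i\tau}$, $q^r=e^{2\pi i r\tau}$ for rational $r$, $(a;q)_\infty=\prod_{k\ge0}(1-aq^k)$, $\eta(\tau)=q^{1/24}(q;q)_\infty$. $g(\tau)=\dfrac{\eta^2(2\tau)\eta^4(5\tau)}{\eta^4(\tau)\eta^2(10\tau)}$. $U(\tau)=I(\tau)/J(\tau)$ where $I(\tau)=q^{3/4}\dfrac{(q;q^{10})_\infty(q^9;q^{10})_\infty}{(q^4;q^{10})_\infty(q^6;q^{10})_\infty}$ and $J(\tau)=q^{1/4}\dfrac{(q^2;q^{10})_\infty(q^8;q^{10})_\infty}{(q^3;q^{10})_\infty(q^7;q^{10})_\infty}$. *)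

theory Defs
  imports "HOL-Analysis.Analysis"
begin

definition qpow :: "real \<Rightarrow> complex \<Rightarrow> complex" where
  "qpow r \<tau> = exp (2 * of_real pi * \<i> * of_real r * \<tau>)"

definition qpoch_inf :: "complex \<Rightarrow> complex \<Rightarrow> complex" where
  "qpoch_inf a q = (\<Prod>k. (1 - a * q ^ k))"

definition eta :: "complex \<Rightarrow> complex" where
  "eta \<tau> = qpow (1/24) \<tau> * qpoch_inf (qpow 1 \<tau>) (qpow 1 \<tau>)"

definition g_fun :: "complex \<Rightarrow> complex" where
  "g_fun \<tau> = (eta (2 * \<tau>) ^ 2 * eta (5 * \<tau>) ^ 4) / (eta \<tau> ^ 4 * eta (10 * \<tau>) ^ 2)"

definition I_fun :: "complex \<Rightarrow> complex" where
  "I_fun \<tau> = (let q = qpow 1 \<tau> in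
     qpow (3/4) \<tau> * (qpoch_inf q (q ^ 10) * qpoch_inf (q ^ 9) (q ^ 10)) /
       (qpoch_inf (q ^ 4) (q ^ 10) * qpoch_inf (q ^ 6) (q ^ 10)))"

definition J_fun :: "complex \<Rightarrow> complex" where
  "J_fun \<tau> = (let q = qpow 1 \<tau> in
     qpow (1/4) \<tau> * (qpoch_inf (q ^ 2) (q ^ 10) * qpoch_inf (q ^ 8) (q ^ 10)) /
       (qpoch_inf (q ^ 3) (q ^ 10) * qpoch_inf (q ^ 7) (q ^ 10)))"

definition U_fun :: "complex \<Rightarrow> complex" where
  "U_fun \<tau> = I_fun \<tau> / J_fun \<tau>"

end

theory Submission
  imports Defs
begin

text \<open>
  Both parts become relations between theta functions: with \<open>\<phi>(q) = \<Sum> q^(n^2)\<close> and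
  \<open>\<psi>(q) = \<Sum>(n \<ge> 0) q^(n(n+1)/2)\<close> one has \<open>g(\<tau>) = (\<phi>(-q^5) / \<phi>(-q))^2\<close> and
  \<open>U(\<tau>) = q^(1/2) \<psi>(q^5) / \<psi>(q)\<close>. The duplication formulas \<open>\<phi>(-q^2)^2 = \<phi>(q) \<phi>(-q)\<close> and
  \<open>\<psi>(q)^2 = \<phi>(q) \<psi>(q^2)\<close> turn both equations into
  \<open>(1 - x^2) (1 - y^2) = 4 x y (1 - x y)\<close>, with \<open>y = \<phi>(q^5) / \<phi>(q)\<close> and
  \<open>x = \<phi>(-q^5) / \<phi>(-q)\<close> in part (1), \<open>x = q \<psi>(q^10) / \<psi>(q^2)\<close> in part (2). All three
  differences factor by the quintic identities
  \<open>\<phi>(q)^2 - \<phi>(q^5)^2 = 4 q f(q, q^9) f(q^3, q^7)\<close> and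
  \<open>\<psi>(q)^2 - q \<psi>(q^5)^2 = f(q, q^4) f(q^2, q^3)\<close>, after which the two sides are the same infinite
  product. The quintic identities come from splitting a double theta series over the five cosets
  of the lattice \<open>(2 + i) \<int>[i]\<close> in \<open>\<int>[i]\<close>; series and products are linked by Jacobi's triple
  product.
\<close>

section \<open>Infinite q-Pochhammer symbols\<close>

lemma convergent_prod_qpoch:
  fixes a q :: complex
  assumes "norm q < 1"
  shows "convergent_prod (\<lambda>k. 1 - a * q ^ k)"
proof -
  have "summable (\<lambda>k. norm (a * q ^ k))"
    using assms by (simp add: norm_mult norm_power)
  then have "abs_convergent_prod (\<lambda>k. 1 + (- (a * q ^ k)))"
    by (simp add: abs_convergent_prod_conv_summable)
  then show ?thesis
    using abs_convergent_prod_imp_convergent_prod by fastforce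
qed

lemma qpoch_inf_LIMSEQ:
  assumes "norm q < 1"
  shows "(\<lambda>n. \<Prod>k<n. 1 - a * q ^ k) \<longlonglongrightarrow> qpoch_inf a q"
  using convergent_prod_LIMSEQ[OF convergent_prod_qpoch[OF assms, of a]]
  unfolding qpoch_inf_def by (simp add: LIMSEQ_lessThan_iff_atMost [symmetric])

lemma qpoch_inf_nonzero:
  assumes "norm q < 1" and "\<And>k. a * q ^ k \<noteq> 1"
  shows "qpoch_inf a q \<noteq> 0"
  unfolding qpoch_inf_def
proof (rule prodinf_nonzero)
  show "1 - a * q ^ k \<noteq> 0" for k
    using assms(2)[of k] by auto
qed (rule convergent_prod_qpoch[OF assms(1)])

lemma qpoch_inf_nonzero_small:
  assumes "norm q < 1" and "norm a < 1"
  shows "qpoch_inf a q \<noteq> 0"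
proof (rule qpoch_inf_nonzero)
  fix k
  have "norm (a * q ^ k) \<le> norm a * 1"
    unfolding norm_mult norm_power using assms by (intro mult_left_mono power_le_one) auto
  then show "a * q ^ k \<noteq> 1" using assms by auto
qed (use assms in auto)

text \<open>The factors are sorted by the residue of their index modulo \<open>m\<close>. For
  partial products of length \<open>n * m\<close> this is a finite rearrangement, and the limit is
  taken along that subsequence.\<close>

lemma qpoch_inf_dissect:
  assumes "norm q < 1" and "m > 0"
  shows "qpoch_inf a q = (\<Prod>i<m. qpoch_inf (a * q ^ i) (q ^ m))"
proof -
  have qm: "norm (q ^ m) < 1" using assms by (simp add: norm_power power_less_one_iff)
  have eq: "(\<Prod>k<n*m. 1 - a * q ^ k) = (\<Prod>i<m. \<Prod>k<n. 1 - a * q ^ i * (q ^ m) ^ k)" for n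
  proof -
    have append: "prod f {..<l + l'} = prod f {..<l} * (\<Prod>i<l'. f (l + i))"
      for f :: "nat \<Rightarrow> complex" and l l'
      by (induction l') (simp_all add: mult_ac)
    have "(\<Prod>k<n*m. 1 - a * q ^ k) = (\<Prod>k<n. \<Prod>i<m. 1 - a * q ^ i * (q ^ m) ^ k)"
    proof (induction n)
      case (Suc n)
      have "(\<Prod>k<Suc n*m. 1 - a * q ^ k) = (\<Prod>k<n*m + m. 1 - a * q ^ k)"
        by (simp add: add.commute)
      then show ?case
        unfolding append Suc.IH by (simp add: power_add mult_ac flip: power_mult)
    qed simp
    also have "\<dots> = (\<Prod>i<m. \<Prod>k<n. 1 - a * q ^ i * (q ^ m) ^ k)"
      by (rule prod.swap)
    finally show ?thesis .
  qed
  have "(\<lambda>n. \<Prod>k<n*m. 1 - a * q ^ k) \<longlonglongrightarrow> qpoch_inf a q"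
    using LIMSEQ_subseq_LIMSEQ[OF qpoch_inf_LIMSEQ[OF assms(1), of a], of "\<lambda>n. n * m"] assms(2)
    by (simp add: o_def strict_mono_def)
  moreover have "(\<lambda>n. \<Prod>k<n*m. 1 - a * q ^ k) \<longlonglongrightarrow> (\<Prod>i<m. qpoch_inf (a * q ^ i) (q ^ m))"
    unfolding eq by (intro tendsto_prod qpoch_inf_LIMSEQ qm)
  ultimately show ?thesis by (rule LIMSEQ_unique)
qed

lemma qpoch_inf_split:
  assumes "norm q < 1"
  shows "qpoch_inf a q = qpoch_inf a (q\<^sup>2) * qpoch_inf (a * q) (q\<^sup>2)"
  using qpoch_inf_dissect[OF assms, of 2 a] by (simp add: lessThan_nat_numeral lessThan_Suc mult_ac)

lemma qpoch_inf_minus_mult: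
  assumes "norm q < 1"
  shows "qpoch_inf a q * qpoch_inf (- a) q = qpoch_inf (a\<^sup>2) (q\<^sup>2)"
proof -
  have "qpoch_inf a q * qpoch_inf (- a) q = (\<Prod>k. (1 - a * q ^ k) * (1 - (- a) * q ^ k))"
    unfolding qpoch_inf_def using assms by (intro prodinf_mult convergent_prod_qpoch)
  also have "\<dots> = qpoch_inf (a\<^sup>2) (q\<^sup>2)"
    unfolding qpoch_inf_def
    by (intro prodinf_cong) (simp add: algebra_simps power2_eq_square power_mult_distrib)
  finally show ?thesis .
qed

lemma qpoch_inf_shift:
  assumes "norm q < 1"
  shows "qpoch_inf a q = (1 - a) * qpoch_inf (a * q) q"
proof -
  have eq: "(\<Prod>k<Suc n. 1 - a * q ^ k) = (1 - a) * (\<Prod>k<n. 1 - a * q * q ^ k)" for n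
    by (subst prod.lessThan_Suc_shift) (simp add: mult_ac)
  have "(\<lambda>n. \<Prod>k<Suc n. 1 - a * q ^ k) \<longlonglongrightarrow> qpoch_inf a q"
    by (rule LIMSEQ_Suc) (rule qpoch_inf_LIMSEQ[OF assms])
  moreover have "(\<lambda>n. \<Prod>k<Suc n. 1 - a * q ^ k) \<longlonglongrightarrow> (1 - a) * qpoch_inf (a * q) q"
    unfolding eq by (intro tendsto_mult qpoch_inf_LIMSEQ assms tendsto_const)
  ultimately show ?thesis by (rule LIMSEQ_unique)
qed

section \<open>Jacobi's triple product\<close>

text \<open>An absolutely convergent unordered sum is an integral for the counting measure, so
  Lebesgue's theorem applies. It carries the limit in the triple product.\<close>

lemma infsum_dominated_convergence:
  fixes f :: "nat \<Rightarrow> 'a \<Rightarrow> complex"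
  assumes sum: "g summable_on A"
    and bound: "\<And>n x. x \<in> A \<Longrightarrow> norm (f n x) \<le> g x"
    and lim: "\<And>x. x \<in> A \<Longrightarrow> (\<lambda>n. f n x) \<longlonglongrightarrow> l x"
  shows "(\<lambda>n. infsum (f n) A) \<longlonglongrightarrow> infsum l A"
proof -
  have g: "norm (g x) = g x" if "x \<in> A" for x
    using order_trans[OF norm_ge_zero bound[OF that]] by simp
  have "(\<lambda>x. norm (g x)) summable_on A"
    using sum by (subst summable_on_cong[OF g])
  then have int: "integrable (count_space A) g"
    using abs_summable_equivalent[of g A] unfolding abs_summable_on_def by blast
  have meas: "l \<in> borel_measurable (count_space A)" "\<And>n. f n \<in> borel_measurable (count_space A)"
    by simp_all
  have l: "AE x in count_space A. (\<lambda>n. f n x) \<longlonglongrightarrow> l x"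
    and b: "\<And>n. AE x in count_space A. norm (f n x) \<le> g x"
    using lim bound by (auto simp: AE_count_space)
  note * = meas int l b
  have "infsum h A = lebesgue_integral (count_space A) h"
    if "integrable (count_space A) h" for h :: "'a \<Rightarrow> complex"
    using infsetsum_infsum[of h A] that by (simp add: abs_summable_on_def infsetsum_def)
  then show ?thesis
    using integral_dominated_convergence[OF *] integrable_dominated_convergence[OF *]
      integrable_dominated_convergence2[OF *] by simp
qed

lemma summable_theta_nat:
  fixes q z :: complex
  assumes "norm q < 1"
  shows "summable (\<lambda>n. norm (q ^ (n\<^sup>2) * z ^ n))"
proof -
  have "(\<lambda>n. norm (q ^ n * z)) \<longlonglongrightarrow> 0"
    using assms by (auto intro!: tendsto_eq_intros LIMSEQ_power_zero tendsto_norm_zero)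
  then have "eventually (\<lambda>n. norm (q ^ n * z) < 1/2) sequentially"
    by (rule order_tendstoD) simp
  then have ev: "eventually (\<lambda>n. norm (q ^ (n\<^sup>2) * z ^ n) \<le> (1/2) ^ n) sequentially"
  proof eventually_elim
    \<comment> \<open>The term is the \<open>n\<close>-th power of \<open>q ^ n * z\<close>, whose
      norm is eventually below 1/2.\<close>
    case (elim n)
    have "norm (q ^ (n\<^sup>2) * z ^ n) = norm (q ^ n * z) ^ n"
      by (simp add: norm_mult norm_power power_mult_distrib power_mult [symmetric] power2_eq_square)
    also have "\<dots> \<le> (1/2) ^ n" using elim by (intro power_mono) auto
    finally show ?case .
  qed
  show ?thesis
    by (rule summable_comparison_test_ev[of _ "\<lambda>n. (1/2) ^ n"]) (use ev in \<open>auto intro: summable_geometric\<close>)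
qed

lemma abs_summable_theta:
  fixes q z :: complex
  assumes "norm q < 1"
  shows "(\<lambda>n::int. norm (q powi n\<^sup>2 * z powi n)) summable_on UNIV"
proof -
  let ?f = "\<lambda>n::int. norm (q powi n\<^sup>2 * z powi n)"
  have *: "(\<lambda>n. norm (q ^ (n\<^sup>2) * w ^ n)) summable_on UNIV" for w
    using summable_theta_nat[OF assms] by (intro summable_nonneg_imp_summable_on) auto
  have "?f summable_on range int"
    using *[of z] by (subst summable_on_reindex) (auto simp: o_def simp flip: of_nat_power)
  \<comment> \<open>Negative indices give the one-sided series with \<open>inverse z\<close> in
    place of \<open>z\<close>.\<close>
  moreover have "?f summable_on range (\<lambda>n. - int n)"
    using *[of "inverse z"]
    by (subst summable_on_reindex) (auto simp: o_def inj_def power_int_minus power_inverse simp flip: of_nat_power)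
  ultimately have "?f summable_on (range int \<union> range (\<lambda>n. - int n))"
    by (rule summable_on_union)
  moreover have "range int \<union> range (\<lambda>n. - int n) = UNIV"
    by (auto simp: image_iff) (metis int_cases2)
  ultimately show ?thesis by simp
qed

text \<open>In Ramanujan's notation, \<open>theta q z = f(q z, q / z)\<close>.\<close>

definition theta :: "complex \<Rightarrow> complex \<Rightarrow> complex" where
  "theta q z = qpoch_inf (q\<^sup>2) (q\<^sup>2) * qpoch_inf (- (z * q)) (q\<^sup>2) * qpoch_inf (- (q / z)) (q\<^sup>2)"

text \<open>The value 0 at negative indices makes \<open>recip_qpoch_rec\<close> hold for all integers, so that the
  finite form of the triple product needs no case distinction at the ends of the range.\<close>

definition recip_qpoch :: "complex \<Rightarrow> int \<Rightarrow> complex" where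
  "recip_qpoch q i = (if i < 0 then 0 else 1 / (\<Prod>k<nat i. 1 - q * q ^ k))"

lemma one_minus_power_nonzero:
  fixes q :: complex
  assumes "norm q < 1"
  shows "1 - q * q ^ k \<noteq> 0"
proof -
  have "norm (q ^ Suc k) < 1"
    using assms by (simp add: norm_power power_less_one_iff del: power_Suc)
  then show ?thesis by auto
qed

lemma recip_qpoch_rec:
  assumes "norm q < 1"
  shows "recip_qpoch q (i - 1) = (1 - q powi i) * recip_qpoch q i"
proof (cases "i > 0")
  case True
  then obtain m where m: "i = int (Suc m)" by (metis gr0_implies_Suc zero_less_imp_eq_int)
  have "recip_qpoch q (int m) = (1 - q ^ Suc m) * recip_qpoch q (int (Suc m))"
    using one_minus_power_nonzero[OF assms, of m] by (simp add: recip_qpoch_def nat_add_distrib)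
  then show ?thesis using m by (simp add: power_int_add_1' flip: power_int_of_nat)
next
  case False
  \<comment> \<open>At \<open>i = 0\<close> the factor \<open>1 - q powi 0\<close> vanishes, which
    matches the value 0 at -1.\<close>
  then show ?thesis by (cases "i = 0") (auto simp: recip_qpoch_def)
qed

lemma recip_qpoch_LIMSEQ:
  assumes "norm q < 1"
  shows "(\<lambda>n. recip_qpoch q (int n)) \<longlonglongrightarrow> 1 / qpoch_inf q q"
  unfolding recip_qpoch_def using assms
  by (auto intro!: tendsto_divide qpoch_inf_LIMSEQ dest: qpoch_inf_nonzero_small)

text \<open>The coefficient of \<open>z powi j\<close> is \<open>q powi j\<^sup>2\<close> times the
  Gaussian binomial of 2n over n + j in base q^2, and it is 0 for |j| > n. The induction matches a
  recurrence of these coefficients with multiplication by the two new factors.\<close>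

lemma jacobi_triple_product_finite:
  fixes q z :: complex
  assumes q: "norm q < 1" "q \<noteq> 0" and z: "z \<noteq> 0"
  shows "((\<lambda>j. q powi j\<^sup>2 * (\<Prod>k<2*n. 1 - q\<^sup>2 * (q\<^sup>2) ^ k) * recip_qpoch (q\<^sup>2) (int n - j)
             * recip_qpoch (q\<^sup>2) (int n + j) * z powi j)
          has_sum (\<Prod>k<n. (1 + z * q * (q\<^sup>2) ^ k) * (1 + q / z * (q\<^sup>2) ^ k))) UNIV"
proof (induction n)
  case 0
  show ?case
    by (rule has_sum_finite_neutralI[where B = "{0}"]) (auto simp: recip_qpoch_def)
next
  case (Suc n)
  define a where "a = recip_qpoch (q\<^sup>2)"
  define D where "D m = (\<Prod>k<2*m. 1 - q\<^sup>2 * (q\<^sup>2) ^ k)" for m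
  define P where "P = (\<Prod>k<n. (1 + z * q * (q\<^sup>2) ^ k) * (1 + q / z * (q\<^sup>2) ^ k))"
  define c where "c m j = q powi j\<^sup>2 * D m * a (int m - j) * a (int m + j)" for m j
  define N where "N = (q\<^sup>2) ^ n"
  have q2: "norm (q\<^sup>2) < 1" using q by (simp add: norm_power power_less_one_iff)
  have IH: "((\<lambda>j. c n j * z powi j) has_sum P) UNIV"
    using Suc.IH by (simp add: c_def a_def D_def P_def)
  have IHs: "((\<lambda>j. c n (j + i) * z powi (j + i)) has_sum P) UNIV" for i
    using IH by (rule has_sum_reindex_bij_witness[of _ "\<lambda>j. j + i" "\<lambda>j. j - i", THEN iffD1, rotated -1]) auto
  \<comment> \<open>Comparison of coefficients in P (1 + z q N) (1 + q N / z), where the factors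
    multiply out to 1 + q^2 N^2 + q N z + q N / z.\<close>
  have rec: "c (Suc n) j = (1 + q\<^sup>2 * N\<^sup>2) * c n j + q * N * c n (j - 1) + q * N * c n (j + 1)" for j
  proof -
    define u where "u = q powi (2 * j)"
    have u: "u \<noteq> 0" using q by (simp add: u_def)
    \<comment> \<open>These are the reciprocals with the largest index on either side;
      \<open>recip_qpoch_rec\<close> makes all the others multiples of them.\<close>
    define A B where "A = a (int n + 1 - j)" and "B = a (int n + 1 + j)"
    have uj: "(q\<^sup>2) powi j = u"
      unfolding u_def power_int_mult by simp
    have p1: "(q\<^sup>2) powi (int n + 1 - j) = q\<^sup>2 * N / u" "(q\<^sup>2) powi (int n + 1 + j) = q\<^sup>2 * N * u"
      and p0: "(q\<^sup>2) powi (int n - j) = N / u" "(q\<^sup>2) powi (int n + j) = N * u"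
      using q by (simp_all add: power_int_add power_int_diff uj N_def)
    have ra: "a (i - 1) = (1 - (q\<^sup>2) powi i) * a i" for i
      using recip_qpoch_rec[OF q2] by (simp add: a_def)
    have a1: "a (int n - j) = (1 - q\<^sup>2 * N / u) * A"
      using ra[of "int n + 1 - j"] p1 by (simp add: A_def)
    have a2: "a (int n + j) = (1 - q\<^sup>2 * N * u) * B"
      using ra[of "int n + 1 + j"] p1 by (simp add: B_def)
    have a3: "a (int n - (j + 1)) = (1 - N / u) * (1 - q\<^sup>2 * N / u) * A"
      using ra[of "int n - j"] p0 a1 by (simp add: diff_diff_eq)
    have a4: "a (int n + (j - 1)) = (1 - N * u) * (1 - q\<^sup>2 * N * u) * B"
      using ra[of "int n + j"] p0 a2 by (simp add: add_diff_eq)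
    have a5: "a (int n - (j - 1)) = A" "a (int n + (j + 1)) = B"
      by (simp_all add: A_def B_def algebra_simps)
    have a6: "a (int (Suc n) - j) = A" "a (int (Suc n) + j) = B"
      by (simp_all add: A_def B_def algebra_simps)
    have D: "D (Suc n) = D n * (1 - q\<^sup>2 * N\<^sup>2) * (1 - q ^ 4 * N\<^sup>2)"
      by (simp add: D_def N_def mult_ac power2_eq_square power4_eq_xxxx power_mult_distrib
          flip: power_mult power_add mult_2)
    have s1: "q powi (j + 1)\<^sup>2 = q powi j\<^sup>2 * (q * u)"
      using q by (simp add: u_def power2_eq_square ring_distribs power_int_add mult_ac flip: mult_2)
    have s2: "q powi (j - 1)\<^sup>2 = q powi j\<^sup>2 * (q / u)"
      using q by (simp add: u_def power2_eq_square ring_distribs power_int_add power_int_diff field_simps flip: mult_2)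
    \<comment> \<open>What is left of the recurrence once the common factor
      \<open>q powi j\<^sup>2 * D n * A * B\<close> is taken out.\<close>
    have poly: "(1 - q\<^sup>2 * N\<^sup>2) * (1 - q ^ 4 * N\<^sup>2) = (1 + q\<^sup>2 * N\<^sup>2) * ((1 - q\<^sup>2 * N / u) * (1 - q\<^sup>2 * N * u))
       + q * N * (q / u) * ((1 - N * u) * (1 - q\<^sup>2 * N * u)) + q * N * (q * u) * ((1 - N / u) * (1 - q\<^sup>2 * N / u))"
      using u by (simp add: field_simps) algebra
    have "c (Suc n) j = q powi j\<^sup>2 * D n * A * B * ((1 - q\<^sup>2 * N\<^sup>2) * (1 - q ^ 4 * N\<^sup>2))"
      unfolding c_def a6 D by (simp only: mult_ac)
    also have "\<dots> = (1 + q\<^sup>2 * N\<^sup>2) * c n j + q * N * c n (j - 1) + q * N * c n (j + 1)"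
      unfolding c_def a1 a2 a3 a4 a5 s1 s2 poly by (simp only: ring_distribs mult_ac)
    finally show ?thesis .
  qed
  have "((\<lambda>j. (1 + q\<^sup>2 * N\<^sup>2) * (c n j * z powi j) + q * N * z * (c n (j + (-1)) * z powi (j + (-1)))
          + q * N / z * (c n (j + 1) * z powi (j + 1))) has_sum
          ((1 + q\<^sup>2 * N\<^sup>2) * P + q * N * z * P + q * N / z * P)) UNIV"
    by (intro has_sum_add has_sum_cmult_right IH IHs)
  also have "(\<lambda>j. (1 + q\<^sup>2 * N\<^sup>2) * (c n j * z powi j) + q * N * z * (c n (j + (-1)) * z powi (j + (-1)))
          + q * N / z * (c n (j + 1) * z powi (j + 1))) = (\<lambda>j. c (Suc n) j * z powi j)"
    using z unfolding rec by (simp add: fun_eq_iff power_int_add power_int_diff field_simps)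
  also have "(1 + q\<^sup>2 * N\<^sup>2) * P + q * N * z * P + q * N / z * P = P * ((1 + z * q * N) * (1 + q / z * N))"
    using z by (simp add: field_simps power2_eq_square)
  finally show ?case
    by (simp add: c_def a_def D_def P_def N_def)
qed

lemma summable_theta:
  fixes q z :: complex
  assumes "norm q < 1"
  shows "(\<lambda>n::int. q powi n\<^sup>2 * z powi n) summable_on UNIV"
  using abs_summable_theta[OF assms] by (rule abs_summable_summable)

text \<open>As n grows in the finite form, the j-th coefficient tends to
  \<open>q powi j\<^sup>2 / E\<close>. Convergent sequences are bounded, so a constant multiple of
  the absolute theta series dominates all the sums.\<close>

theorem jacobi_triple_product:
  fixes q z :: complex
  assumes q: "norm q < 1" "q \<noteq> 0" and z: "z \<noteq> 0"
  shows "((\<lambda>n::int. q powi n\<^sup>2 * z powi n) has_sum theta q z) UNIV"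
proof -
  have q2: "norm (q\<^sup>2) < 1" using q by (simp add: norm_power power_less_one_iff)
  define a where "a = recip_qpoch (q\<^sup>2)"
  define D where "D m = (\<Prod>k<m. 1 - q\<^sup>2 * (q\<^sup>2) ^ k)" for m
  define E where "E = qpoch_inf (q\<^sup>2) (q\<^sup>2)"
  define t where "t j = q powi j\<^sup>2 * z powi j" for j
  define S where "S n = (\<Prod>k<n. (1 + z * q * (q\<^sup>2) ^ k) * (1 + q / z * (q\<^sup>2) ^ k))" for n
  have E: "E \<noteq> 0" unfolding E_def using q2 by (intro qpoch_inf_nonzero_small)
  have D_lim: "D \<longlonglongrightarrow> E"
    unfolding D_def E_def by (rule qpoch_inf_LIMSEQ[OF q2])
  have a_lim: "(\<lambda>n. a (int n)) \<longlonglongrightarrow> 1 / E"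
    unfolding a_def E_def by (rule recip_qpoch_LIMSEQ[OF q2])
  obtain CD where CD: "\<And>n. norm (D n) \<le> CD"
    using convergent_imp_Bseq[OF convergentI[OF D_lim]] by (auto simp: Bseq_def)
  obtain Ca where Ca': "\<And>n. norm (a (int n)) \<le> Ca" and "Ca > 0"
    using convergent_imp_Bseq[OF convergentI[OF a_lim]] by (auto simp: Bseq_def)
  then have Ca: "norm (a i) \<le> Ca" for i
    by (cases "i < 0") (use Ca'[of "nat i"] in \<open>auto simp: a_def recip_qpoch_def\<close>)
  have CD0: "CD \<ge> 0" using order_trans[OF norm_ge_zero CD] .
  have fin: "((\<lambda>j. D (2*n) * a (int n - j) * a (int n + j) * t j) has_sum S n) UNIV" for n
    using jacobi_triple_product_finite[OF q z, of n]
    by (simp add: a_def D_def t_def S_def mult_ac)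
  have "(\<lambda>n. infsum (\<lambda>j. D (2*n) * a (int n - j) * a (int n + j) * t j) UNIV) \<longlonglongrightarrow> infsum (\<lambda>j. E * (1/E) * (1/E) * t j) UNIV"
  proof (rule infsum_dominated_convergence)
    show "(\<lambda>j. CD * Ca * Ca * norm (t j)) summable_on UNIV"
      unfolding t_def by (intro summable_on_cmult_right abs_summable_theta q)
  next
    fix n :: nat and j :: int
    show "norm (D (2*n) * a (int n - j) * a (int n + j) * t j) \<le> CD * Ca * Ca * norm (t j)"
      unfolding norm_mult using CD0 \<open>Ca > 0\<close> by (intro mult_mono CD Ca) auto
  next
    fix j :: int
    \<comment> \<open>For negative \<open>i\<close> the offset skips the initial \<open>n\<close> at
      which the index is negative.\<close>
    have shift: "(\<lambda>n. a (int n + i)) \<longlonglongrightarrow> 1 / E" for i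
    proof (rule LIMSEQ_offset[of _ "nat (- i)"])
      have "(\<lambda>n. a (int (n + nat i))) \<longlonglongrightarrow> 1 / E"
        by (rule LIMSEQ_ignore_initial_segment[OF a_lim])
      also have "(\<lambda>n. a (int (n + nat i))) = (\<lambda>n. a (int (n + nat (- i)) + i))"
        by (intro ext arg_cong[of _ _ a]) auto
      finally show "(\<lambda>n. a (int (n + nat (- i)) + i)) \<longlonglongrightarrow> 1 / E" .
    qed
    have "(\<lambda>n. D (2 * n)) \<longlonglongrightarrow> E"
      using LIMSEQ_subseq_LIMSEQ[OF D_lim, of "\<lambda>n. 2 * n"] by (simp add: o_def strict_mono_def)
    then show "(\<lambda>n. D (2*n) * a (int n - j) * a (int n + j) * t j) \<longlonglongrightarrow> E * (1/E) * (1/E) * t j"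
      using shift[of j] shift[of "-j"] by (intro tendsto_mult tendsto_const) auto
  qed
  also have "(\<lambda>n. infsum (\<lambda>j. D (2*n) * a (int n - j) * a (int n + j) * t j) UNIV) = S"
    using fin by (intro ext infsumI)
  also have "infsum (\<lambda>j. E * (1/E) * (1/E) * t j) UNIV = 1 / E * infsum t UNIV"
    using E by (subst infsum_cmult_right') (simp add: infsum_cmult_right')
  finally have "S \<longlonglongrightarrow> 1 / E * infsum t UNIV" .
  moreover have "S \<longlonglongrightarrow> qpoch_inf (- (z * q)) (q\<^sup>2) * qpoch_inf (- (q / z)) (q\<^sup>2)"
    using tendsto_mult[OF qpoch_inf_LIMSEQ[OF q2, of "- (z * q)"] qpoch_inf_LIMSEQ[OF q2, of "- (q / z)"]]
    unfolding S_def prod.distrib by simp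
  ultimately have "1 / E * infsum t UNIV = qpoch_inf (- (z * q)) (q\<^sup>2) * qpoch_inf (- (q / z)) (q\<^sup>2)"
    by (rule LIMSEQ_unique)
  then have "infsum t UNIV = theta q z"
    using E by (simp add: theta_def E_def field_simps)
  moreover have "t summable_on UNIV" unfolding t_def by (rule summable_theta[OF q(1)])
  ultimately show ?thesis unfolding t_def by (simp add: has_sum_iff)
qed

section \<open>Quintic dissection and theta identities\<close>

lemma has_sum_product:
  fixes f :: "'a \<Rightarrow> complex" and g :: "'b \<Rightarrow> complex"
  assumes f: "(f has_sum a) A" and g: "(g has_sum b) B"
  shows "((\<lambda>(x, y). f x * g y) has_sum (a * b)) (A \<times> B)"
proof -
  \<comment> \<open>Summability of complex families is absolute, which yields summability on the
    product set.\<close>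
  have F: "(\<lambda>x. norm (f x)) summable_on A" and G: "(\<lambda>x. norm (g x)) summable_on B"
    using f g by (auto simp: has_sum_iff simp flip: summable_on_iff_abs_summable_on_complex)
  have "(\<lambda>p. norm ((\<lambda>(x, y). f x * g y) p)) summable_on (A \<times> B)"
    unfolding Infinite_Sum.abs_summable_on_Sigma_iff using F G
    by (auto simp: norm_mult infsum_cmult_right' abs_mult
        intro!: summable_on_cmult_right summable_on_cmult_left)
  then have S: "(\<lambda>(x, y). f x * g y) summable_on (A \<times> B)"
    by (rule abs_summable_summable)
  show ?thesis
  proof (rule has_sum_SigmaI[where g = "\<lambda>x. f x * b"])
    show "((\<lambda>x. f x * b) has_sum (a * b)) A" by (rule has_sum_cmult_left[OF f])
    show "((\<lambda>y. (case (x, y) of (x, y) \<Rightarrow> f x * g y)) has_sum f x * b) B" for x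
      using has_sum_cmult_right[OF g] by simp
  qed (rule S)
qed

text \<open>The points \<open>(2m + n, 2n - m)\<close> form a sublattice of index 5; the coset of \<open>(a, b)\<close> is
  determined by \<open>a + 2b\<close> modulo 5.\<close>

lemma has_sum_quintic:
  fixes h :: "int \<times> int \<Rightarrow> complex"
  assumes h: "(h has_sum S) UNIV"
    and s: "\<And>r. r \<in> {-2..2} \<Longrightarrow> ((\<lambda>(m, n). h (2 * m + n + r, 2 * n - m)) has_sum s r) UNIV"
  shows "S = (\<Sum>r\<in>{-2..2}. s r)"
proof -
  have "((\<lambda>(r, m, n). h (2 * m + n + r, 2 * n - m)) has_sum S) ({-2..2} \<times> UNIV)"
    using h
    \<comment> \<open>For a = 2m + n + r and b = 2n - m one has a + 2b = 5n + r. Adding 2 turns the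
      representatives -2..2 into remainders 0..4; then m = 2n - b.\<close>
    by (rule has_sum_reindex_bij_witness[where
        i = "\<lambda>(a, b). ((a + 2 * b + 2) mod 5 - 2, 2 * ((a + 2 * b + 2) div 5) - b, (a + 2 * b + 2) div 5)" and
        j = "\<lambda>(r, m, n). (2 * m + n + r, 2 * n - m)", THEN iffD2, rotated -1]) (auto, presburger+)
  then have "(s has_sum S) {-2..2}"
    by (rule has_sum_SigmaD) (use s in auto)
  then show ?thesis
    by (simp add: has_sum_finite_iff)
qed

text \<open>On a coset, a^2 + b^2 = 5 m^2 + 5 n^2 + 4 r m + 2 r n + r^2 has no mixed term m n, so
  the double sum factors into two theta series of nome q^5. The exponent a + b = r + m + 3n produces
  the arguments with z and z^3.\<close>

lemma theta_square_quintic: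
  fixes q z :: complex
  assumes q: "norm q < 1" "q \<noteq> 0" and z: "z \<noteq> 0"
  shows "(theta q z)\<^sup>2 = (\<Sum>r\<in>{-2..2}. q powi r\<^sup>2 * z powi r *
           (theta (q ^ 5) (q powi (4 * r) * z) * theta (q ^ 5) (q powi (2 * r) * z ^ 3)))"
  unfolding power2_eq_square[of "theta q z"]
proof (rule has_sum_quintic)
  show "((\<lambda>(a, b). q powi a\<^sup>2 * z powi a * (q powi b\<^sup>2 * z powi b)) has_sum theta q z * theta q z) UNIV"
    using has_sum_product[OF jacobi_triple_product[OF q z] jacobi_triple_product[OF q z]] by simp
next
  fix r :: int
  have q5: "norm (q ^ 5) < 1" "q ^ 5 \<noteq> 0" using q by (auto simp: norm_power power_less_one_iff)
  have *: "(case (2 * m + n + r, 2 * n - m) of (a, b) \<Rightarrow> q powi a\<^sup>2 * z powi a * (q powi b\<^sup>2 * z powi b)) =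
     q powi r\<^sup>2 * z powi r * ((q ^ 5) powi m\<^sup>2 * (q powi (4 * r) * z) powi m *
       ((q ^ 5) powi n\<^sup>2 * (q powi (2 * r) * z ^ 3) powi n))" for m n
  proof -
    have "(case (2 * m + n + r, 2 * n - m) of (a, b) \<Rightarrow> q powi a\<^sup>2 * z powi a * (q powi b\<^sup>2 * z powi b)) =
        q powi ((2 * m + n + r)\<^sup>2 + (2 * n - m)\<^sup>2) * z powi (2 * m + n + r + (2 * n - m))"
      using q z by (simp only: power_int_add prod.case simp_thms mult_ac)
    also have "(2 * m + n + r)\<^sup>2 + (2 * n - m)\<^sup>2 = r\<^sup>2 + 5 * m\<^sup>2 + 4 * r * m + 5 * n\<^sup>2 + 2 * r * n"
      by (simp add: power2_eq_square algebra_simps)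
    also have "2 * m + n + r + (2 * n - m) = r + m + 3 * n" by simp
    also have "q powi (r\<^sup>2 + 5 * m\<^sup>2 + 4 * r * m + 5 * n\<^sup>2 + 2 * r * n) * z powi (r + m + 3 * n) =
       q powi r\<^sup>2 * (q powi 5) powi m\<^sup>2 * (q powi (4 * r)) powi m * (q powi 5) powi n\<^sup>2
         * (q powi (2 * r)) powi n * (z powi r * z powi m * (z powi 3) powi n)"
      using q z by (simp only: power_int_add power_int_mult simp_thms)
    finally show ?thesis
      by (simp add: power_int_mult_distrib mult_ac)
  qed
  show "((\<lambda>(m, n). case (2 * m + n + r, 2 * n - m) of (a, b) \<Rightarrow> q powi a\<^sup>2 * z powi a * (q powi b\<^sup>2 * z powi b))
     has_sum q powi r\<^sup>2 * z powi r *
           (theta (q ^ 5) (q powi (4 * r) * z) * theta (q ^ 5) (q powi (2 * r) * z ^ 3))) UNIV"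
    unfolding *
    using has_sum_cmult_right[OF has_sum_product[OF jacobi_triple_product[OF q5, of "q powi (4 * r) * z"]
          jacobi_triple_product[OF q5, of "q powi (2 * r) * z ^ 3"]], of "q powi r\<^sup>2 * z powi r"] q z
    by (simp add: case_prod_unfold)
qed

section \<open>Symmetry, quasi-periodicity and the quintic identities\<close>

lemma theta_inverse: "theta q (inverse z) = theta q z"
  by (simp add: theta_def field_simps)

lemma theta_minus_nome: "theta (- q) z = theta q (- z)"
  by (simp add: theta_def)

text \<open>The shift of \<open>z\<close> removes one factor from one product and adds one to the
  other. Their quotient (1 + z q) / (1 + 1 / (z q)) is z q, but no division by them occurs, so they
  may vanish.\<close>

lemma theta_quasiperiod:
  assumes q: "norm q < 1" "q \<noteq> 0" and z: "z \<noteq> 0"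
  shows "theta q z = z * q * theta q (z * q\<^sup>2)"
proof -
  have q2: "norm (q\<^sup>2) < 1" using q by (simp add: norm_power power_less_one_iff)
  define A where "A = qpoch_inf (- (z * q * q\<^sup>2)) (q\<^sup>2)"
  define B where "B = qpoch_inf (- (q / z)) (q\<^sup>2)"
  have 1: "qpoch_inf (- (z * q)) (q\<^sup>2) = (1 + z * q) * A"
    using qpoch_inf_shift[OF q2, of "- (z * q)"] by (simp add: A_def)
  have 2: "qpoch_inf (- (q / (z * q\<^sup>2))) (q\<^sup>2) = (1 + 1 / (z * q)) * B"
    using qpoch_inf_shift[OF q2, of "- (q / (z * q\<^sup>2))"] q z by (simp add: B_def power2_eq_square)
  have 3: "qpoch_inf (- (z * q\<^sup>2 * q)) (q\<^sup>2) = A"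
    by (simp add: A_def mult_ac)
  show ?thesis
    unfolding theta_def 1 2 3 B_def[symmetric] using q z by (simp add: field_simps)
qed

text \<open>At z = 1 the coset r = 0 gives the square, and the other four agree by inversion and
  quasi-periodicity.\<close>

lemma theta_phi_quintic:
  assumes q: "norm q < 1" "q \<noteq> 0"
  shows "(theta q 1)\<^sup>2 = (theta (q ^ 5) 1)\<^sup>2 + 4 * q * theta (q ^ 5) (q ^ 4) * theta (q ^ 5) (q\<^sup>2)"
proof -
  have q5: "norm (q ^ 5) < 1" "q ^ 5 \<noteq> 0" using q by (auto simp: norm_power power_less_one_iff)
  have I: "theta (q ^ 5) (inverse (q ^ k)) = theta (q ^ 5) (q ^ k)" for k by (rule theta_inverse)
  have 8: "theta (q ^ 5) (q\<^sup>2) = q ^ 3 * theta (q ^ 5) (q ^ 8)"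
    using theta_quasiperiod[OF q5, of "inverse (q\<^sup>2)"] q I[of 2]
    by (simp add: field_simps power_diff[symmetric] flip: power_mult)
  have set: "{-2..2} = {-2, -1, 0, 1, 2::int}" by auto
  show ?thesis
    unfolding theta_square_quintic[OF q one_neq_zero] set
    by (simp add: power_int_minus I 8) (simp add: power2_eq_square eval_nat_numeral)
qed

text \<open>Since \<open>theta q q\<close> is 2 psi(q^2), this is the psi identity at q^2. Now the
  coset r = 1 gives the square, and the other four agree.\<close>

lemma theta_psi_quintic:
  assumes q: "norm q < 1" "q \<noteq> 0"
  shows "(theta q q)\<^sup>2 = q\<^sup>2 * (theta (q ^ 5) (q ^ 5))\<^sup>2 + 4 * theta (q ^ 5) (q ^ 3) * theta (q ^ 5) q"
proof -
  have q5: "norm (q ^ 5) < 1" "q ^ 5 \<noteq> 0" using q by (auto simp: norm_power power_less_one_iff)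
  have I: "theta (q ^ 5) (inverse (q ^ k)) = theta (q ^ 5) (q ^ k)" for k by (rule theta_inverse)
  have 9: "theta (q ^ 5) q = q ^ 4 * theta (q ^ 5) (q ^ 9)"
    using theta_quasiperiod[OF q5, of "inverse q"] q theta_inverse[of "q^5" q]
    by (simp add: field_simps flip: power_mult power_add) (simp add: eval_nat_numeral)
  have 7: "theta (q ^ 5) (q ^ 3) = q ^ 2 * theta (q ^ 5) (q ^ 7)"
    using theta_quasiperiod[OF q5, of "inverse (q ^ 3)"] q I[of 3]
    by (simp add: field_simps power_diff[symmetric] flip: power_mult)
  have set: "{-2..2} = {-2, -1, 0, 1, 2::int}" by auto
  have sum5: "(\<Sum>r\<in>{-2..2}. f r) = f (-2) + f (-1) + f 0 + f 1 + f 2" for f :: "int \<Rightarrow> complex"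
    by (simp add: set)
  have e: "q powi (4 * (-2)) * q = inverse (q ^ 7)" "q powi (2 * (-2)) * q ^ 3 = inverse q"
     "q powi (4 * (-1)) * q = inverse (q ^ 3)" "q powi (2 * (-1)) * q ^ 3 = q"
     "q powi (4 * 0) * q = q" "q powi (2 * 0) * q ^ 3 = q ^ 3"
     "q powi (4 * 1) * q = q ^ 5" "q powi (2 * 1) * q ^ 3 = q ^ 5"
     "q powi (4 * 2) * q = q ^ 9" "q powi (2 * 2) * q ^ 3 = q ^ 7"
     "q powi (-2)\<^sup>2 * q powi (-2) = q ^ 2" "q powi (-1)\<^sup>2 * q powi (-1) = 1" "q powi 0\<^sup>2 * q powi 0 = 1"
     "q powi 1\<^sup>2 * q powi 1 = q ^ 2" "q powi 2\<^sup>2 * q powi 2 = q ^ 6"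
    using q by (simp_all add: power_int_minus field_simps flip: power_Suc power_Suc2 power_add power2_eq_square)
  show ?thesis
    unfolding theta_square_quintic[OF q q(2)] sum5 e I theta_inverse 7 9 by (simp add: power2_eq_square eval_nat_numeral)
qed

text \<open>Factors at z and -z pair up as differences of squares, and (q^2; q^2)^2, split in base
  q^4, supplies the rest. At z = 1 this is phi(q) phi(-q) = phi(-q^2)^2.\<close>

lemma theta_mult_theta_minus:
  assumes q: "norm q < 1"
  shows "theta q z * theta q (- z) = theta (q\<^sup>2) (- z\<^sup>2) * theta (q\<^sup>2) (- 1)"
proof -
  have q2: "norm (q\<^sup>2) < 1" using q by (simp add: norm_power power_less_one_iff)
  have e: "theta q z * theta q (- z) = (qpoch_inf (q\<^sup>2) (q\<^sup>2))\<^sup>2 *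
      (qpoch_inf (z * q) (q\<^sup>2) * qpoch_inf (- (z * q)) (q\<^sup>2)) *
      (qpoch_inf (q / z) (q\<^sup>2) * qpoch_inf (- (q / z)) (q\<^sup>2))"
    by (simp add: theta_def power2_eq_square mult_ac)
  show ?thesis
    unfolding e qpoch_inf_minus_mult[OF q2]
    unfolding qpoch_inf_split[OF q2, of "q\<^sup>2"] theta_def
    by (simp add: power2_eq_square mult_ac)
qed

lemma theta_psi_conv:
  assumes q: "norm q < 1" "q \<noteq> 0"
  shows "theta q q = 2 * qpoch_inf (q\<^sup>2) (q\<^sup>2) * (qpoch_inf (- (q\<^sup>2)) (q\<^sup>2))\<^sup>2"
proof -
  have q2: "norm (q\<^sup>2) < 1" using q by (simp add: norm_power power_less_one_iff)
  show ?thesis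
    using qpoch_inf_shift[OF q2, of "-1"] q by (simp add: theta_def power2_eq_square)
qed

text \<open>Splitting the products of \<open>theta q z\<close> into base q^4 gives exactly the
  factors on the right. At z = q this is psi(q^2)^2 = phi(q^2) psi(q^4).\<close>

lemma theta_mult_theta_psi:
  assumes q: "norm q < 1" "q \<noteq> 0"
  shows "theta q z * theta q q = 2 * theta (q\<^sup>2) (z * q) * theta (q\<^sup>2) (z / q)"
proof -
  have q2: "norm (q\<^sup>2) < 1" using q by (simp add: norm_power power_less_one_iff)
  define E where "E = qpoch_inf (q\<^sup>2) (q\<^sup>2)"
  define F where "F = qpoch_inf (- (q\<^sup>2)) (q\<^sup>2)"
  have EF: "qpoch_inf ((q\<^sup>2)\<^sup>2) ((q\<^sup>2)\<^sup>2) = E * F"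
    unfolding E_def F_def qpoch_inf_minus_mult[OF q2] ..
  have a: "z * q * q\<^sup>2 = z * q ^ 3" "z / q * q\<^sup>2 = z * q" "q\<^sup>2 / (z * q) = q / z"
          "q\<^sup>2 / (z / q) = q ^ 3 / z" "q / z * q\<^sup>2 = q ^ 3 / z"
    using q by (simp_all add: eval_nat_numeral)
  show ?thesis
    unfolding theta_psi_conv[OF q] unfolding theta_def EF a
    unfolding qpoch_inf_split[OF q2, of "- (z * q)"] qpoch_inf_split[OF q2, of "- (q / z)"]
      E_def[symmetric] F_def[symmetric]
    unfolding mult_minus_left a by (simp only: power2_eq_square[of F] mult_ac)
qed

text \<open>The eta quotient for phi(-q); it serves both to rewrite \<open>g_fun\<close> and to show
  that phi(-q) does not vanish.\<close>

lemma theta_minus_one_conv: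
  assumes q: "norm q < 1"
  shows "theta q (- 1) * qpoch_inf (q\<^sup>2) (q\<^sup>2) = (qpoch_inf q q)\<^sup>2"
  unfolding qpoch_inf_split[OF q, of q] theta_def by (simp add: power2_eq_square)

lemma theta_minus_one_nonzero:
  assumes q: "norm q < 1"
  shows "theta q (- 1) \<noteq> 0"
  using theta_minus_one_conv[OF q] qpoch_inf_nonzero_small[OF q q] by auto

text \<open>Gauss's product psi(q^2) = (q^4; q^4) / (q^2; q^4), free of division.\<close>

lemma theta_psi_mult:
  assumes q: "norm q < 1" "q \<noteq> 0"
  shows "theta q q * qpoch_inf (q\<^sup>2) (q ^ 4) = 2 * qpoch_inf (q ^ 4) (q ^ 4)"
proof -
  have q2: "norm (q\<^sup>2) < 1" using q by (simp add: norm_power power_less_one_iff)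
  define F where "F = qpoch_inf (- (q\<^sup>2)) (q\<^sup>2)"
  have 1: "qpoch_inf (q\<^sup>2) (q\<^sup>2) * F = qpoch_inf (q ^ 4) (q ^ 4)"
    unfolding F_def qpoch_inf_minus_mult[OF q2] by simp
  have 2: "qpoch_inf (q\<^sup>2) (q\<^sup>2) = qpoch_inf (q\<^sup>2) (q ^ 4) * qpoch_inf (q ^ 4) (q ^ 4)"
    using qpoch_inf_split[OF q2, of "q\<^sup>2"] by (simp flip: power_add)
  have nz: "qpoch_inf (q ^ 4) (q ^ 4) \<noteq> 0"
    using q by (intro qpoch_inf_nonzero_small) (auto simp: norm_power power_less_one_iff)
  \<comment> \<open>Euler's identity between partitions into distinct parts and into odd
    parts.\<close>
  have "F * qpoch_inf (q\<^sup>2) (q ^ 4) = 1"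
    using 1 nz unfolding 2 by (simp add: mult_ac)
  moreover have "theta q q * qpoch_inf (q\<^sup>2) (q ^ 4) =
      2 * (qpoch_inf (q\<^sup>2) (q\<^sup>2) * F) * (F * qpoch_inf (q\<^sup>2) (q ^ 4))"
    unfolding theta_psi_conv[OF q] F_def[symmetric] by (simp only: power2_eq_square[of F] mult_ac)
  ultimately show ?thesis unfolding 1 by simp
qed

lemma theta_psi_nonzero:
  assumes q: "norm q < 1" "q \<noteq> 0"
  shows "theta q q \<noteq> 0"
proof -
  have "qpoch_inf (q ^ 4) (q ^ 4) \<noteq> 0"
    using q by (intro qpoch_inf_nonzero_small) (auto simp: norm_power power_less_one_iff)
  then show ?thesis using theta_psi_mult[OF q] by auto
qed

section \<open>The modular equations\<close>

lemma qpow_mult_nat: "qpow r (of_nat n * \<tau>) = qpow r \<tau> ^ n"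
  by (simp add: qpow_def mult_ac flip: exp_of_nat_mult)

lemma qpow_power: "qpow r \<tau> ^ n = qpow (of_nat n * r) \<tau>"
  by (simp add: qpow_def mult_ac flip: exp_of_nat_mult)

lemma qpow_nonzero: "qpow r \<tau> \<noteq> 0"
  by (simp add: qpow_def)

lemma norm_qpow_less_1:
  assumes "Im \<tau> > 0" "r > 0"
  shows "norm (qpow r \<tau>) < 1"
  using assms by (simp add: qpow_def norm_exp_eq_Re)

lemma eta_mult_nat:
  "eta (of_nat n * \<tau>) = qpow (1/24) \<tau> ^ n * qpoch_inf (qpow 1 \<tau> ^ n) (qpow 1 \<tau> ^ n)"
  by (simp add: eta_def qpow_mult_nat)

text \<open>The powers of q^(1/24) cancel: 2 * 2 + 5 * 4 = 4 + 10 * 2.\<close>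

lemma g_fun_conv_theta:
  assumes "Im \<tau> > 0"
  defines "q \<equiv> qpow 1 \<tau>"
  shows "g_fun \<tau> = (theta (q ^ 5) (- 1) / theta q (- 1))\<^sup>2"
proof -
  have q: "norm q < 1" unfolding q_def using assms by (intro norm_qpow_less_1) auto
  have qn: "norm (q ^ n) < 1" if "n > 0" for n
    using q that by (simp add: norm_power power_less_one_iff)
  define E where "E n = qpoch_inf (q ^ n) (q ^ n)" for n
  define s where "s = qpow (1/24) \<tau>"
  have s: "s \<noteq> 0" by (simp add: s_def qpow_nonzero)
  have E: "E n \<noteq> 0" if "n > 0" for n
    unfolding E_def using qn[OF that] by (intro qpoch_inf_nonzero_small)
  have eta: "eta \<tau> = s * E 1" "eta (2 * \<tau>) = s ^ 2 * E 2" "eta (5 * \<tau>) = s ^ 5 * E 5"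
    "eta (10 * \<tau>) = s ^ 10 * E 10"
    using eta_mult_nat[of 1 \<tau>] eta_mult_nat[of 2 \<tau>] eta_mult_nat[of 5 \<tau>] eta_mult_nat[of 10 \<tau>]
    by (simp_all add: E_def s_def q_def)
  have t1: "theta q (- 1) = (E 1)\<^sup>2 / E 2"
    using theta_minus_one_conv[OF q] E[of 2] by (simp add: E_def field_simps)
  have t5: "theta (q ^ 5) (- 1) = (E 5)\<^sup>2 / E 10"
    using theta_minus_one_conv[OF qn[of 5]] E[of 10] by (simp add: E_def field_simps flip: power_mult)
  show ?thesis
    unfolding g_fun_def eta t1 t5 using s E[of 1] E[of 2] E[of 5] E[of 10]
    by (simp add: field_simps flip: power_mult power_add)
qed

text \<open>The nome is q^(1/2) because \<open>theta p p\<close> is 2 psi(p^2). Dissecting its base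
  q^2 products into base q^10 gives all \<open>X 1\<close> to \<open>X 10\<close>;
  \<open>X 5\<close> and \<open>X 10\<close> cancel against
  \<open>theta (p ^ 5) (p ^ 5)\<close>.\<close>

lemma U_fun_conv_theta:
  assumes "Im \<tau> > 0"
  defines "p \<equiv> qpow (1/2) \<tau>"
  shows "U_fun \<tau> = p * theta (p ^ 5) (p ^ 5) / theta p p"
proof -
  define q where "q = qpow 1 \<tau>"
  have p: "norm p < 1" "p \<noteq> 0"
    unfolding p_def using assms by (auto intro!: norm_qpow_less_1 simp: qpow_nonzero)
  have p5: "norm (p ^ 5) < 1" "p ^ 5 \<noteq> 0" using p by (auto simp: norm_power power_less_one_iff)
  have pq: "p\<^sup>2 = q" by (simp add: p_def q_def qpow_power)
  have q: "norm q < 1" unfolding q_def using assms by (intro norm_qpow_less_1) auto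
  have qn: "norm (q ^ n) < 1" if "n > 0" for n
    using q that by (simp add: norm_power power_less_one_iff)
  define X where "X n = qpoch_inf (q ^ n) (q ^ 10)" for n
  have X: "X n \<noteq> 0" if "n > 0" for n
    unfolding X_def using qn[OF that] qn[of 10] by (intro qpoch_inf_nonzero_small) auto
  have pp: "p ^ 4 = q\<^sup>2" "(p ^ 5)\<^sup>2 = q ^ 5" "(p ^ 5) ^ 4 = q ^ 10"
    by (simp_all flip: pq power_mult)
  have d: "qpoch_inf (q ^ m) (q\<^sup>2) = X m * X (m + 2) * X (m + 4) * X (m + 6) * X (m + 8)" for m
    using qpoch_inf_dissect[OF qn[of 2], of 5 "q ^ m"]
    by (simp add: X_def eval_nat_numeral lessThan_Suc mult_ac flip: power_mult power_add)
  have t1: "theta p p * (X 1 * X 3 * X 5 * X 7 * X 9) = 2 * (X 2 * X 4 * X 6 * X 8 * X 10)"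
    using theta_psi_mult[OF p] d[of 1] d[of 2] by (simp add: pq pp flip: numeral_3_eq_3)
  have t5: "theta (p ^ 5) (p ^ 5) * X 5 = 2 * X 10"
    using theta_psi_mult[OF p5] by (simp only: pp X_def)
  have t1': "theta p p = 2 * (X 2 * X 4 * X 6 * X 8 * X 10) / (X 1 * X 3 * X 5 * X 7 * X 9)"
    using t1 X by (subst eq_divide_eq) auto
  have t5': "theta (p ^ 5) (p ^ 5) = 2 * X 10 / X 5"
    using t5 X by (subst eq_divide_eq) auto
  have s: "qpow (3/4) \<tau> = p * qpow (1/4) \<tau>"
    by (simp add: p_def qpow_def algebra_simps flip: exp_add)
  show ?thesis
    unfolding U_fun_def I_fun_def J_fun_def Let_def q_def[symmetric] t1' t5' s
    using X[of 1] X[of 2] X[of 3] X[of 4] X[of 5] X[of 6] X[of 7] X[of 8] X[of 9] X[of 10] qpow_nonzero[of "1/4" \<tau>]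
    by (simp add: X_def field_simps)
qed

lemma g_modular_equation:
  assumes "Im \<tau> > 0"
  shows "g_fun \<tau> - g_fun \<tau> ^ 2 - 4 * g_fun \<tau> * g_fun (2 * \<tau>) - g_fun (2 * \<tau>) ^ 2
           + 5 * g_fun \<tau> * g_fun (2 * \<tau>) ^ 2 = 0"
proof -
  define q where "q = qpow 1 \<tau>"
  have q: "norm q < 1" "q \<noteq> 0"
    unfolding q_def using assms by (auto intro!: norm_qpow_less_1 simp: qpow_nonzero)
  have qn: "norm (q ^ n) < 1" if "n > 0" for n
    using q that by (simp add: norm_power power_less_one_iff)
  have qq: "qpow 1 (2 * \<tau>) = q\<^sup>2"
    using qpow_mult_nat[of 1 2 \<tau>] by (simp add: q_def)
  define P Q p r where "P = theta q (- 1)" and "Q = theta q 1" and "p = theta (q ^ 5) (- 1)" and "r = theta (q ^ 5) 1"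
  have PQ: "(theta (q\<^sup>2) (- 1))\<^sup>2 = P * Q"
    using theta_mult_theta_minus[OF q(1), of 1] by (simp add: P_def Q_def power2_eq_square mult_ac)
  have pr: "(theta (q ^ 10) (- 1))\<^sup>2 = p * r"
    using theta_mult_theta_minus[OF qn[of 5], of 1]
    by (simp add: p_def r_def power2_eq_square[of "theta _ _"] mult_ac flip: power_mult)
  have nz: "P \<noteq> 0" "Q \<noteq> 0"
    using theta_minus_one_nonzero[OF qn[of 2]] PQ by auto
  have g1: "g_fun \<tau> = (p / P)\<^sup>2"
    unfolding g_fun_conv_theta[OF assms] P_def p_def q_def ..
  have "Im (2 * \<tau>) > 0" using assms by simp
  from g_fun_conv_theta[OF this] have g2: "g_fun (2 * \<tau>) = (p * r) / (P * Q)"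
    unfolding qq power_divide by (simp add: PQ pr flip: power_mult)
  define a b a' b' c d where "a = theta (q ^ 5) (q ^ 4)" and "b = theta (q ^ 5) (q\<^sup>2)"
    and "a' = theta (q ^ 5) (- (q ^ 4))" and "b' = theta (q ^ 5) (- (q\<^sup>2))"
    and "c = theta (q ^ 10) (- (q ^ 8))" and "d = theta (q ^ 10) (- (q ^ 4))"
  \<comment> \<open>The phi identity is used at the nomes q, -q and -q^2; a negative nome amounts to
    a negated argument.\<close>
  have A: "Q\<^sup>2 = r\<^sup>2 + 4 * q * a * b"
    using theta_phi_quintic[OF q] by (simp add: Q_def r_def a_def b_def)
  have A': "P\<^sup>2 = p\<^sup>2 - 4 * q * a' * b'"
    using theta_phi_quintic[of "- q"] q by (simp add: P_def p_def a'_def b'_def theta_minus_nome)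
  have A'': "P * Q = p * r - 4 * q\<^sup>2 * c * d"
    using theta_phi_quintic[of "- (q\<^sup>2)"] q qn[of 2]
    by (simp add: theta_minus_nome PQ pr c_def d_def flip: power_mult)
  \<comment> \<open>Duplication turns \<open>a * a'\<close> and \<open>b * b'\<close> into
    \<open>c\<close> and \<open>d\<close>, each times \<open>theta (q ^ 10) (- 1)\<close>, whose
    square is \<open>p * r\<close>.\<close>
  have T: "a * a' * (b * b') = p * r * (c * d)"
    using theta_mult_theta_minus[OF qn[of 5], of "q ^ 4"] theta_mult_theta_minus[OF qn[of 5], of "q\<^sup>2"]
    by (simp add: a_def b_def a'_def b'_def c_def d_def power2_eq_square[of "theta _ _"] mult_ac
         flip: power_mult pr)
  have "(P\<^sup>2 - p\<^sup>2) * (Q\<^sup>2 - r\<^sup>2) = 4 * p * r * (P * Q - p * r)"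
    unfolding A A' A'' using T by (simp add: mult_ac) algebra
  then have "P\<^sup>2 * Q\<^sup>2 - p\<^sup>2 * Q\<^sup>2 - 4 * p * r * P * Q - r\<^sup>2 * P\<^sup>2 + 5 * p\<^sup>2 * r\<^sup>2 = 0"
    by algebra
  moreover have "g_fun \<tau> - g_fun \<tau> ^ 2 - 4 * g_fun \<tau> * g_fun (2 * \<tau>) - g_fun (2 * \<tau>) ^ 2
           + 5 * g_fun \<tau> * g_fun (2 * \<tau>) ^ 2 = p\<^sup>2 / (P ^ 4 * Q\<^sup>2) *
           (P\<^sup>2 * Q\<^sup>2 - p\<^sup>2 * Q\<^sup>2 - 4 * p * r * P * Q - r\<^sup>2 * P\<^sup>2 + 5 * p\<^sup>2 * r\<^sup>2)"
    unfolding g1 g2 using nz by (simp add: field_simps power2_eq_square power4_eq_xxxx)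
  ultimately show ?thesis by simp
qed

lemma U_modular_equation:
  assumes "Im \<tau> > 0"
  shows "U_fun \<tau> ^ 4 + 4 * U_fun \<tau> ^ 2 * U_fun (2 * \<tau>) ^ 2 + U_fun (2 * \<tau>) ^ 4
           = U_fun (2 * \<tau>) ^ 2 * (1 + 5 * U_fun \<tau> ^ 4)"
proof -
  define p where "p = qpow (1/2) \<tau>"
  define q where "q = qpow 1 \<tau>"
  have p: "norm p < 1" "p \<noteq> 0"
    unfolding p_def using assms by (auto intro!: norm_qpow_less_1 simp: qpow_nonzero)
  have p5: "norm (p ^ 5) < 1" "p ^ 5 \<noteq> 0" using p by (auto simp: norm_power power_less_one_iff)
  have q: "norm q < 1" "q \<noteq> 0"
    unfolding q_def using assms by (auto intro!: norm_qpow_less_1 simp: qpow_nonzero)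
  have pq: "p\<^sup>2 = q" by (simp add: p_def q_def qpow_power)
  have qq: "qpow (1/2) (2 * \<tau>) = q"
    using qpow_mult_nat[of "1/2" 2 \<tau>] by (simp add: p_def flip: pq)
  define u v w z Q r where "u = theta p p" and "v = theta (p ^ 5) (p ^ 5)" and "w = theta q q"
    and "z = theta (q ^ 5) (q ^ 5)" and "Q = theta q 1" and "r = theta (q ^ 5) 1"
  have pp: "(p ^ 5)\<^sup>2 = q ^ 5" "p ^ 10 = q ^ 5"
    by (simp_all flip: pq power_mult)
  have u: "u\<^sup>2 = 2 * (Q * w)"
    using theta_mult_theta_psi[OF p, of p] p
    by (simp add: u_def Q_def w_def power2_eq_square[of "theta _ _"] mult_ac pq flip: power2_eq_square[of p])
  have v: "v\<^sup>2 = 2 * (r * z)"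
    using theta_mult_theta_psi[OF p5, of "p ^ 5"] p
    by (simp add: v_def r_def z_def power2_eq_square[of "theta _ _"] mult_ac pp)
  have nz: "u \<noteq> 0" "w \<noteq> 0" "Q \<noteq> 0"
    using theta_psi_nonzero[OF p] theta_psi_nonzero[OF q] u by (auto simp: u_def w_def)
  \<comment> \<open>Here \<open>x\<close> is the quotient of phi values and \<open>Y\<close> that of
    psi values, called y and x in the opening outline.\<close>
  define x Y where "x = r / Q" and "Y = q * z / w"
  have "Im (2 * \<tau>) > 0" using assms by simp
  from U_fun_conv_theta[OF this] have U2: "U_fun (2 * \<tau>) = Y"
    unfolding qq by (simp add: Y_def z_def w_def)
  have U1: "U_fun \<tau> ^ 2 = x * Y"
    unfolding U_fun_conv_theta[OF assms] p_def[symmetric] u_def[symmetric] v_def[symmetric]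
    using nz by (simp add: power_divide power_mult_distrib pq u v x_def Y_def)
  define a b c d where "a = theta (q ^ 5) (q ^ 4)" and "b = theta (q ^ 5) (q\<^sup>2)"
    and "c = theta (q ^ 5) (q ^ 3)" and "d = theta (q ^ 5) q"
  define e f where "e = theta (p ^ 5) (p ^ 3)" and "f = theta (p ^ 5) p"
  have A: "Q\<^sup>2 = r\<^sup>2 + 4 * q * a * b"
    using theta_phi_quintic[OF q] by (simp add: Q_def r_def a_def b_def)
  have B: "w\<^sup>2 = q\<^sup>2 * z\<^sup>2 + 4 * c * d"
    using theta_psi_quintic[OF q] by (simp add: w_def z_def c_def d_def)
  have "2 * (Q * w) = 2 * (q * (r * z) + 2 * e * f)"
    using theta_psi_quintic[OF p] u v by (simp add: u_def v_def e_def f_def pq algebra_simps)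
  then have B': "Q * w = q * (r * z) + 2 * e * f"
    unfolding mult_cancel_left by simp
  \<comment> \<open>Multiplication by \<open>v\<close> moves \<open>e\<close> and \<open>f\<close>
    from nome p^5 to nome q^5, where \<open>a\<close>, \<open>b\<close>, \<open>c\<close>,
    \<open>d\<close> live; \<open>v\<^sup>2\<close> is then replaced by
    \<open>2 * (r * z)\<close>.\<close>
  have "p ^ 3 * p ^ 5 = q ^ 4" "p ^ 3 / p ^ 5 = inverse q" "p * p ^ 5 = q ^ 3" "p / p ^ 5 = inverse (q\<^sup>2)"
    using p by (simp_all add: field_simps eval_nat_numeral flip: pq)
  then have ev: "e * v = 2 * a * d" and fv: "f * v = 2 * c * b"
    using theta_mult_theta_psi[OF p5, of "p ^ 3"] theta_mult_theta_psi[OF p5, of p]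
    by (simp_all add: e_def f_def v_def a_def b_def c_def d_def pp theta_inverse)
  have T: "2 * (a * b * c * d) = e * f * (r * z)"
    using v ev fv by algebra
  have "(Q\<^sup>2 - r\<^sup>2) * (w\<^sup>2 - q\<^sup>2 * z\<^sup>2) = 4 * q * (r * z) * (Q * w - q * (r * z))"
    unfolding A B B' using T by algebra
  then have "r\<^sup>2 * w\<^sup>2 + 4 * r * Q * (q * z) * w + (q * z)\<^sup>2 * Q\<^sup>2 = Q\<^sup>2 * w\<^sup>2 + 5 * r\<^sup>2 * (q * z)\<^sup>2"
    by algebra
  then have "x\<^sup>2 + 4 * x * Y + Y\<^sup>2 = 1 + 5 * x\<^sup>2 * Y\<^sup>2"
    unfolding x_def Y_def using nz by (simp add: field_simps power2_eq_square)
  \<comment> \<open>Multiplication by \<open>Y\<^sup>2\<close> leaves \<open>x\<close> only inside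
    \<open>x * Y\<close>, the square of \<open>U_fun \<tau>\<close>.\<close>
  then have "(x * Y)\<^sup>2 + 4 * (x * Y) * Y\<^sup>2 + Y ^ 4 = Y\<^sup>2 * (1 + 5 * (x * Y)\<^sup>2)"
    by algebra
  moreover have "U_fun \<tau> ^ 4 = (x * Y)\<^sup>2"
    by (simp flip: U1 power_mult)
  ultimately show ?thesis
    by (simp add: U1 U2)
qed

theorem theorem4p5:
  fixes \<tau> :: complex
  assumes "Im \<tau> > 0"
  shows "g_fun \<tau> - g_fun \<tau> ^ 2 - 4 * g_fun \<tau> * g_fun (2 * \<tau>) - g_fun (2 * \<tau>) ^ 2
           + 5 * g_fun \<tau> * g_fun (2 * \<tau>) ^ 2 = 0 \<and>
         U_fun \<tau> ^ 4 + 4 * U_fun \<tau> ^ 2 * U_fun (2 * \<tau>) ^ 2 + U_fun (2 * \<tau>) ^ 4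
           = U_fun (2 * \<tau>) ^ 2 * (1 + 5 * U_fun \<tau> ^ 4)"
  using g_modular_equation[OF assms] U_modular_equation[OF assms] by blast

end
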